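(* Let $\{i,j\}=\{1,2\}$ and let $(L,L_1,L_2)$ be a bilocale. If $(\mathfrak B L,\nu_{\mathfrak B L}[L_1],\nu_{\mathfrak B L}[L_2])$ is $(i,j)$-Baire as a bilocale, then $(L,L_1,L_2)$ is $(i,j)$-Baire.
   Context: A locale is a complete lattice $L$ with $a\wedge\bigvee B=\bigvee\{a\wedge b:b\in B\}$ for all $a\in L$, $B\subseteq L$; $\to$ is its Heyting operation. A subframe of $L$ is a subset closed under all joins and finite meets. A bilocale is a triple $(L,L_1,L_2)$ with $L_1,L_2$ subframes of a locale $L$ such that $a=\bigvee\{a_1\wedge a_2:a_1\in L_1,a_2\in L_2,a_1\wedge a_2\le a\}$ for all $a\in L$. A sublocale of $L$ is a subset $S$ closed under all meets with $x\to s\in S$ for all $x\in L$, $s\in S$; it is itself a locale in the induced order. For a sublocale $S$, $\nu_S:L\to S$ is the onto frame homomorphism $\nu_S(a)=\bigwedge\{s\in S:a\le s\}$. $\mathfrak B L=\{x\to 0:x\in L\}$ is the smallest dense sublocale of $L$. The triple $(S,\nu_S[L_1],\nu_S[L_2])$ is called a subbilocale of $(L,L_1,L_2)$ and is a bilocale. For $a\in L$, $\mathfrak o(a)=\{a\to x:x\in L\}$ is an open sublocale and $\mathfrak c(a)=\{x\in L:a\le x\}$ a closed sublocale. A sublocale is $j$-open if it equals $\mathfrak o(a)$ for some $a\in L_j$; $S$ is $i$-dense if $\bigcap\{\mathfrak c(a):a\in L_i,\ S\subseteq\mathfrak c(a)\}=L$. A bilocale is $(i,j)$-Baire if the intersection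 of any countably many $i$-dense $j$-open sublocales is $i$-dense. *)

theory Defs
  imports "HOL-Algebra.Complete_Lattice" "HOL-Library.Countable_Set"
begin

text \<open>
  Locales are represented by the carrier-based orders of \<open>HOL-Algebra\<close>, so that a sublocale
  \<open>S\<close> of \<open>L\<close>, with the induced order, is again such an object, namely \<open>L\<lparr>carrier := S\<rparr>\<close>.
\<close>

definition is_locale :: "('a, 'b) gorder_scheme \<Rightarrow> bool" where
  "is_locale L \<longleftrightarrow> complete_lattice L \<and>
     (\<forall>a \<in> carrier L. \<forall>B \<subseteq> carrier L. a \<sqinter>\<^bsub>L\<^esub> (\<Squnion>\<^bsub>L\<^esub> B) = \<Squnion>\<^bsub>L\<^esub> {a \<sqinter>\<^bsub>L\<^esub> b | b. b \<in> B})"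

definition heyting :: "('a, 'b) gorder_scheme \<Rightarrow> 'a \<Rightarrow> 'a \<Rightarrow> 'a" where
  "heyting L x y = \<Squnion>\<^bsub>L\<^esub> {z \<in> carrier L. x \<sqinter>\<^bsub>L\<^esub> z \<sqsubseteq>\<^bsub>L\<^esub> y}"

text \<open>The empty join and the empty meet are included, so a subframe contains bottom and top.\<close>

definition is_subframe :: "('a, 'b) gorder_scheme \<Rightarrow> 'a set \<Rightarrow> bool" where
  "is_subframe L K \<longleftrightarrow> K \<subseteq> carrier L \<and>
     (\<forall>A \<subseteq> K. \<Squnion>\<^bsub>L\<^esub> A \<in> K) \<and> (\<forall>A \<subseteq> K. finite A \<longrightarrow> \<Sqinter>\<^bsub>L\<^esub> A \<in> K)"

definition is_bilocale :: "('a, 'b) gorder_scheme \<Rightarrow> 'a set \<Rightarrow> 'a set \<Rightarrow> bool" where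
  "is_bilocale L L1 L2 \<longleftrightarrow> is_locale L \<and> is_subframe L L1 \<and> is_subframe L L2 \<and>
     (\<forall>a \<in> carrier L.
        a = \<Squnion>\<^bsub>L\<^esub> {a1 \<sqinter>\<^bsub>L\<^esub> a2 | a1 a2. a1 \<in> L1 \<and> a2 \<in> L2 \<and> a1 \<sqinter>\<^bsub>L\<^esub> a2 \<sqsubseteq>\<^bsub>L\<^esub> a})"

definition is_sublocale :: "('a, 'b) gorder_scheme \<Rightarrow> 'a set \<Rightarrow> bool" where
  "is_sublocale L S \<longleftrightarrow> S \<subseteq> carrier L \<and> (\<forall>A \<subseteq> S. \<Sqinter>\<^bsub>L\<^esub> A \<in> S) \<and>
     (\<forall>x \<in> carrier L. \<forall>s \<in> S. heyting L x s \<in> S)"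

definition nucleus :: "('a, 'b) gorder_scheme \<Rightarrow> 'a set \<Rightarrow> 'a \<Rightarrow> 'a" where
  "nucleus L S a = \<Sqinter>\<^bsub>L\<^esub> {s \<in> S. a \<sqsubseteq>\<^bsub>L\<^esub> s}"

definition booleanization :: "('a, 'b) gorder_scheme \<Rightarrow> 'a set" where
  "booleanization L = {heyting L x \<bottom>\<^bsub>L\<^esub> | x. x \<in> carrier L}"

definition open_sublocale :: "('a, 'b) gorder_scheme \<Rightarrow> 'a \<Rightarrow> 'a set" where
  "open_sublocale L a = {heyting L a x | x. x \<in> carrier L}"

definition closed_sublocale :: "('a, 'b) gorder_scheme \<Rightarrow> 'a \<Rightarrow> 'a set" where
  "closed_sublocale L a = {x \<in> carrier L. a \<sqsubseteq>\<^bsub>L\<^esub> x}"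

text \<open>Only the indices 1 and 2 are meaningful.\<close>

definition part :: "'a set \<Rightarrow> 'a set \<Rightarrow> nat \<Rightarrow> 'a set" where
  "part L1 L2 k = (if k = 1 then L1 else L2)"

definition is_open_in ::
  "('a, 'b) gorder_scheme \<Rightarrow> 'a set \<Rightarrow> 'a set \<Rightarrow> nat \<Rightarrow> 'a set \<Rightarrow> bool" where
  "is_open_in L L1 L2 j S \<longleftrightarrow>
     is_sublocale L S \<and> (\<exists>a \<in> part L1 L2 j. S = open_sublocale L a)"

definition is_dense_in ::
  "('a, 'b) gorder_scheme \<Rightarrow> 'a set \<Rightarrow> 'a set \<Rightarrow> nat \<Rightarrow> 'a set \<Rightarrow> bool" where
  "is_dense_in L L1 L2 i S \<longleftrightarrow> is_sublocale L S \<and>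
     \<Inter> {closed_sublocale L a | a. a \<in> part L1 L2 i \<and> S \<subseteq> closed_sublocale L a} = carrier L"

text \<open>
  Intersecting with \<open>carrier L\<close> only matters for the empty family, whose intersection is
  the whole of \<open>L\<close>.
\<close>

definition is_Baire ::
  "('a, 'b) gorder_scheme \<Rightarrow> 'a set \<Rightarrow> 'a set \<Rightarrow> nat \<Rightarrow> nat \<Rightarrow> bool" where
  "is_Baire L L1 L2 i j \<longleftrightarrow>
     (\<forall>F. countable F \<and> (\<forall>S \<in> F. is_dense_in L L1 L2 i S \<and> is_open_in L L1 L2 j S) \<longrightarrow>
        is_dense_in L L1 L2 i (carrier L \<inter> \<Inter> F))"

end

theory Submission
  imports Defs
begin

text \<open>
  The sublocale \<open>\<oo>(b)\<close> is \<open>i\<close>-dense iff \<open>a \<le> b \<rightarrow> 0\<close> forces \<open>a = 0\<close> for \<open>a \<in> L\<^sub>i\<close>. In a sublocale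
  \<open>S\<close> the open sublocale of \<open>\<nu>\<^sub>S(b)\<close> is \<open>{b \<rightarrow> x : x \<in> S} \<subseteq> \<oo>(b)\<close>, and when \<open>0 \<in> S\<close> it contains
  \<open>b \<rightarrow> 0\<close>, so it inherits \<open>i\<close>-density from \<open>\<oo>(b)\<close>. Hence countably many \<open>i\<close>-dense \<open>j\<close>-open
  sublocales of \<open>L\<close> have traces in \<open>S\<close> to which the Baire property of \<open>S\<close> applies, and any \<open>\<cc>(a)\<close>
  containing the intersection in \<open>L\<close> restricts to a closed sublocale of \<open>\<nu>\<^sub>S(a)\<close> containing the
  intersection of the traces. Only density of the Booleanization matters.
\<close>

section \<open>Frames and order-theoretic preliminaries\<close>

locale frame = complete_lattice +
  assumes meet_sup_distrib:
    "\<lbrakk>a \<in> carrier L; B \<subseteq> carrier L\<rbrakk> \<Longrightarrow> a \<sqinter> \<Squnion>B = \<Squnion>{a \<sqinter> b | b. b \<in> B}"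

lemma is_locale_iff_frame: "is_locale L \<longleftrightarrow> frame L"
  by (auto simp: is_locale_def frame_def frame_axioms_def)

context frame
begin

lemma le_meet_iff:
  assumes "x \<in> carrier L" "y \<in> carrier L" "z \<in> carrier L"
  shows "z \<sqsubseteq> x \<sqinter> y \<longleftrightarrow> z \<sqsubseteq> x \<and> z \<sqsubseteq> y"
  using assms by (meson le_trans meet_closed meet_le meet_left meet_right)

lemma le_inf_iff:
  assumes "A \<subseteq> carrier L" "z \<in> carrier L"
  shows "z \<sqsubseteq> \<Sqinter>A \<longleftrightarrow> (\<forall>x \<in> A. z \<sqsubseteq> x)"
  using assms by (meson inf_closed inf_greatest inf_lower le_trans subsetD)

lemma sup_le_iff:
  assumes "A \<subseteq> carrier L" "z \<in> carrier L"
  shows "\<Squnion>A \<sqsubseteq> z \<longleftrightarrow> (\<forall>x \<in> A. x \<sqsubseteq> z)"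
  using assms by (meson sup_closed sup_least sup_upper le_trans subsetD)

text \<open>Antisymmetry in Yoneda form: equations between Heyting implications reduce to comparing
  the elements below each side, where the adjunction applies.\<close>

lemma le_eqI:
  assumes "x \<in> carrier L" "y \<in> carrier L" "\<And>z. z \<in> carrier L \<Longrightarrow> z \<sqsubseteq> x \<longleftrightarrow> z \<sqsubseteq> y"
  shows "x = y"
  using assms by (meson le_antisym le_refl)

section \<open>Arithmetic of the Heyting operation\<close>

lemma heyting_closed [simp]: "heyting L x y \<in> carrier L"
  by (auto simp: heyting_def intro: sup_closed)

text \<open>Frame distributivity enters here: it moves the meet with \<open>x\<close> inside the
  join defining \<open>heyting\<close>, whose terms then lie below \<open>y\<close>.\<close>

lemma meet_heyting_le:
  assumes "x \<in> carrier L" "y \<in> carrier L"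
  shows "x \<sqinter> heyting L x y \<sqsubseteq> y"
proof -
  have "x \<sqinter> heyting L x y = \<Squnion>{x \<sqinter> z | z. z \<in> {z \<in> carrier L. x \<sqinter> z \<sqsubseteq> y}}"
    unfolding heyting_def using assms by (intro meet_sup_distrib) auto
  also have "\<dots> \<sqsubseteq> y"
    using assms by (intro sup_least) auto
  finally show ?thesis .
qed

lemma le_heyting_iff:
  assumes "x \<in> carrier L" "y \<in> carrier L" "z \<in> carrier L"
  shows "z \<sqsubseteq> heyting L x y \<longleftrightarrow> x \<sqinter> z \<sqsubseteq> y"
proof
  assume z: "z \<sqsubseteq> heyting L x y"
  have "x \<sqinter> z \<sqsubseteq> x \<sqinter> heyting L x y"
    using assms le_trans[OF meet_right z] by (simp add: le_meet_iff meet_left)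
  then show "x \<sqinter> z \<sqsubseteq> y"
    using assms le_trans[OF _ meet_heyting_le[OF assms(1,2)]] by simp
next
  assume "x \<sqinter> z \<sqsubseteq> y"
  then show "z \<sqsubseteq> heyting L x y"
    unfolding heyting_def using assms by (intro sup_upper) auto
qed

text \<open>Both sides say \<open>x \<sqinter> z \<sqsubseteq> y\<close>. The swap turns the
  antitone argument of an implication into a lower bound, which suits joins and nuclei.\<close>

lemma le_heyting_swap:
  assumes "x \<in> carrier L" "y \<in> carrier L" "z \<in> carrier L"
  shows "z \<sqsubseteq> heyting L x y \<longleftrightarrow> x \<sqsubseteq> heyting L z y"
  using assms by (simp add: le_heyting_iff meet_comm)

lemma heyting_heyting:
  assumes "x \<in> carrier L" "y \<in> carrier L" "z \<in> carrier L"
  shows "heyting L x (heyting L y z) = heyting L (x \<sqinter> y) z"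
  by (rule le_eqI)
    (use assms in \<open>simp_all add: le_heyting_iff, metis meet_assoc meet_comm\<close>)

lemma heyting_left_commute:
  assumes "x \<in> carrier L" "y \<in> carrier L" "z \<in> carrier L"
  shows "heyting L x (heyting L y z) = heyting L y (heyting L x z)"
  using assms by (simp add: heyting_heyting meet_comm)

text \<open>By the adjunction, \<open>heyting L b\<close> is a right adjoint, hence preserves
  meets.\<close>

lemma heyting_inf:
  assumes "b \<in> carrier L" "A \<subseteq> carrier L"
  shows "heyting L b (\<Sqinter>A) = \<Sqinter>(heyting L b ` A)"
proof (rule le_eqI)
  fix z assume "z \<in> carrier L"
  then show "z \<sqsubseteq> heyting L b (\<Sqinter>A) \<longleftrightarrow> z \<sqsubseteq> \<Sqinter>(heyting L b ` A)"
    using assms by (subst le_inf_iff) (auto simp: le_heyting_iff le_inf_iff subset_iff)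
qed (use assms in \<open>auto intro!: inf_closed\<close>)

text \<open>After a swap the join stands on the left of the order, where it splits into its members;
  each is then swapped back.\<close>

lemma heyting_sup:
  assumes "X \<subseteq> carrier L" "y \<in> carrier L"
  shows "heyting L (\<Squnion>X) y = \<Sqinter>((\<lambda>x. heyting L x y) ` X)"
proof (rule le_eqI)
  fix z assume z: "z \<in> carrier L"
  have "z \<sqsubseteq> heyting L (\<Squnion>X) y \<longleftrightarrow> (\<forall>x \<in> X. x \<sqsubseteq> heyting L z y)"
    using assms z by (subst le_heyting_swap) (auto simp: sup_le_iff)
  also have "\<dots> \<longleftrightarrow> (\<forall>x \<in> X. z \<sqsubseteq> heyting L x y)"
    using assms z le_heyting_swap by blast
  also have "\<dots> \<longleftrightarrow> z \<sqsubseteq> \<Sqinter>((\<lambda>x. heyting L x y) ` X)"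
    using assms z by (subst le_inf_iff) auto
  finally show "z \<sqsubseteq> heyting L (\<Squnion>X) y \<longleftrightarrow> z \<sqsubseteq> \<Sqinter>((\<lambda>x. heyting L x y) ` X)" .
qed (use assms in \<open>auto intro!: inf_closed\<close>)

lemma heyting_mono:
  assumes "x \<in> carrier L" "y \<in> carrier L" "z \<in> carrier L" "y \<sqsubseteq> z"
  shows "heyting L x y \<sqsubseteq> heyting L x z"
  using assms le_trans[OF meet_heyting_le assms(4)] by (simp add: le_heyting_iff)

section \<open>Sublocales and the Booleanization\<close>

lemma is_sublocale_Inter:
  assumes "\<And>S. S \<in> F \<Longrightarrow> is_sublocale L S"
  shows "is_sublocale L (carrier L \<inter> \<Inter>F)"
  using assms by (auto simp: is_sublocale_def le_Inf_iff)

text \<open>A meet of pseudocomplements is the pseudocomplement of the join, and \<open>x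
  \<rightarrow> (y \<rightarrow> 0) = (x \<sqinter> y) \<rightarrow> 0\<close>.\<close>

lemma is_sublocale_booleanization: "is_sublocale L (booleanization L)"
  unfolding is_sublocale_def
proof (intro conjI allI ballI impI)
  show "booleanization L \<subseteq> carrier L"
    by (auto simp: booleanization_def)
next
  fix A assume "A \<subseteq> booleanization L"
  then have "A \<subseteq> (\<lambda>x. heyting L x \<bottom>) ` carrier L"
    by (auto simp: booleanization_def)
  then obtain X where X: "X \<subseteq> carrier L" "A = (\<lambda>x. heyting L x \<bottom>) ` X"
    by (auto simp: subset_image_iff)
  then have "\<Sqinter>A = heyting L (\<Squnion>X) \<bottom>"
    by (simp add: heyting_sup)
  then show "\<Sqinter>A \<in> booleanization L"
    using X by (auto simp: booleanization_def)
next
  fix x s assume "x \<in> carrier L" "s \<in> booleanization L"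
  then show "heyting L x s \<in> booleanization L"
    unfolding booleanization_def using heyting_heyting meet_closed bottom_closed by blast
qed

text \<open>This is density of the Booleanization; the witness is
  \<open>\<top> \<rightarrow> \<bottom>\<close>.\<close>

lemma bottom_in_booleanization: "\<bottom> \<in> booleanization L"
proof -
  have "heyting L \<top> \<bottom> \<sqsubseteq> \<bottom>"
    using meet_heyting_le[of \<top> \<bottom>] by (metis bottom_closed eq_is_equal heyting_closed top_closed top_meet)
  then have "\<bottom> = heyting L \<top> \<bottom>"
    by (simp add: le_antisym)
  then show ?thesis
    unfolding booleanization_def using top_closed by blast
qed

end

section \<open>A sublocale in its induced order\<close>

locale frame_sublocale = frame +
  fixes S
  assumes is_sublocale: "is_sublocale L S"
begin

lemma subset_carrier: "S \<subseteq> carrier L"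
  using is_sublocale by (simp add: is_sublocale_def)

lemma in_carrier: "s \<in> S \<Longrightarrow> s \<in> carrier L"
  using subset_carrier by blast

lemma inf_in: "A \<subseteq> S \<Longrightarrow> \<Sqinter>A \<in> S"
  using is_sublocale by (simp add: is_sublocale_def)

lemma heyting_in: "x \<in> carrier L \<Longrightarrow> s \<in> S \<Longrightarrow> heyting L x s \<in> S"
  using is_sublocale by (simp add: is_sublocale_def)

text \<open>The meet is a Hilbert choice of a greatest lower bound. The meet in \<open>L\<close>
  lies in \<open>S\<close>, so it is such a bound there too, and antisymmetry makes it the only
  one.\<close>

lemma inf_restrict:
  assumes "A \<subseteq> S"
  shows "\<Sqinter>\<^bsub>L\<lparr>carrier := S\<rparr>\<^esub> A = \<Sqinter>A"
  unfolding inf_def[of "L\<lparr>carrier := S\<rparr>"]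
proof (rule some_equality)
  have A: "A \<subseteq> carrier L"
    using assms subset_carrier by blast
  show *: "greatest (L\<lparr>carrier := S\<rparr>) (\<Sqinter>A) (Lower (L\<lparr>carrier := S\<rparr>) A)"
    using assms A subset_carrier inf_in
    by (auto simp: greatest_def Lower_def intro!: inf_lower inf_greatest)
  fix x assume "greatest (L\<lparr>carrier := S\<rparr>) x (Lower (L\<lparr>carrier := S\<rparr>) A)"
  with * have "x \<sqsubseteq> \<Sqinter>A" "\<Sqinter>A \<sqsubseteq> x" "x \<in> S"
    by (auto simp: greatest_def Lower_def)
  then show "x = \<Sqinter>A"
    using A by (simp add: in_carrier le_antisym)
qed

text \<open>Joins in \<open>S\<close> may differ from joins in \<open>L\<close>, but
  \<open>heyting L x s\<close> lies in \<open>S\<close> and is the maximum of the set to be joined,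
  so it is the join in either order.\<close>

lemma heyting_restrict:
  assumes "x \<in> S" "s \<in> S"
  shows "heyting (L\<lparr>carrier := S\<rparr>) x s = heyting L x s"
proof -
  let ?Z = "{z \<in> S. x \<sqinter> z \<sqsubseteq> s}" and ?h = "heyting L x s"
  have [simp]: "x \<sqinter>\<^bsub>L\<lparr>carrier := S\<rparr>\<^esub> z = x \<sqinter> z" if "z \<in> S" for z
    using that assms by (simp add: meet_def inf_restrict)
  have "?h \<in> ?Z"
    using assms by (simp add: heyting_in in_carrier meet_heyting_le)
  moreover have "z \<sqsubseteq> ?h" if "z \<in> ?Z" for z
    using that assms by (simp add: in_carrier le_heyting_iff)
  ultimately have *: "least (L\<lparr>carrier := S\<rparr>) ?h (Upper (L\<lparr>carrier := S\<rparr>) ?Z)"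
    by (auto simp: least_def Upper_def)
  have "\<Squnion>\<^bsub>L\<lparr>carrier := S\<rparr>\<^esub> ?Z = ?h"
    unfolding sup_def
  proof (rule some_equality)
    fix y assume "least (L\<lparr>carrier := S\<rparr>) y (Upper (L\<lparr>carrier := S\<rparr>) ?Z)"
    with * have "y \<sqsubseteq> ?h" "?h \<sqsubseteq> y" "y \<in> S"
      by (auto simp: least_def Upper_def)
    then show "y = ?h"
      by (simp add: in_carrier le_antisym)
  qed (rule *)
  moreover have "{z \<in> S. x \<sqinter>\<^bsub>L\<lparr>carrier := S\<rparr>\<^esub> z \<sqsubseteq> s} = ?Z"
    by auto
  ultimately show ?thesis
    by (simp add: heyting_def)
qed

lemma is_sublocale_restrictI:
  assumes "is_sublocale L T" "T \<subseteq> S"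
  shows "is_sublocale (L\<lparr>carrier := S\<rparr>) T"
  unfolding is_sublocale_def
proof (intro conjI allI ballI impI)
  fix A assume "A \<subseteq> T"
  then show "\<Sqinter>\<^bsub>L\<lparr>carrier := S\<rparr>\<^esub> A \<in> T"
    using assms by (subst inf_restrict) (auto simp: is_sublocale_def)
next
  fix x s assume "x \<in> carrier (L\<lparr>carrier := S\<rparr>)" "s \<in> T"
  then show "heyting (L\<lparr>carrier := S\<rparr>) x s \<in> T"
    using assms by (subst heyting_restrict) (auto simp: is_sublocale_def in_carrier)
qed (use assms in simp)

text \<open>Meets pass through \<open>heyting L b\<close>, and \<open>x \<rightarrow> (b
  \<rightarrow> t) = b \<rightarrow> (x \<rightarrow> t)\<close> with
  \<open>x \<rightarrow> t\<close> again in \<open>S\<close>.\<close>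

lemma is_sublocale_heyting_image:
  assumes b: "b \<in> carrier L"
  shows "is_sublocale L (heyting L b ` S)"
  unfolding is_sublocale_def
proof (intro conjI allI ballI impI)
  fix A assume "A \<subseteq> heyting L b ` S"
  then obtain X where X: "X \<subseteq> S" "A = heyting L b ` X"
    by (auto simp: subset_image_iff)
  then have "\<Sqinter>A = heyting L b (\<Sqinter>X)"
    using b subset_carrier by (simp add: heyting_inf)
  then show "\<Sqinter>A \<in> heyting L b ` S"
    using X inf_in by blast
next
  fix x s assume x: "x \<in> carrier L" and "s \<in> heyting L b ` S"
  then obtain t where "t \<in> S" "s = heyting L b t"
    by blast
  then have "heyting L x s = heyting L b (heyting L x t)" "heyting L x t \<in> S"
    using b x by (simp_all add: heyting_left_commute heyting_in in_carrier)
  then show "heyting L x s \<in> heyting L b ` S"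
    by blast
qed (use assms in auto)

section \<open>The nucleus and open sublocales of \<open>S\<close>\<close>

lemma nucleus_in: "nucleus L S a \<in> S"
  unfolding nucleus_def by (rule inf_in) auto

text \<open>The nucleus is left adjoint to the inclusion of \<open>S\<close> into
  \<open>L\<close>.\<close>

lemma nucleus_le_iff:
  assumes "a \<in> carrier L" "s \<in> S"
  shows "nucleus L S a \<sqsubseteq> s \<longleftrightarrow> a \<sqsubseteq> s"
proof
  let ?A = "{s \<in> S. a \<sqsubseteq> s}"
  have A: "?A \<subseteq> carrier L"
    using subset_carrier by blast
  assume "nucleus L S a \<sqsubseteq> s"
  moreover have "a \<sqsubseteq> nucleus L S a"
    unfolding nucleus_def using A assms by (intro inf_greatest) auto
  ultimately show "a \<sqsubseteq> s"
    using assms by (meson in_carrier le_trans nucleus_in)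
next
  assume "a \<sqsubseteq> s"
  then show "nucleus L S a \<sqsubseteq> s"
    unfolding nucleus_def using subset_carrier assms by (intro inf_lower) auto
qed

text \<open>After a swap the nucleus stands below \<open>heyting L z x\<close>, an element of
  \<open>S\<close>, so the adjunction removes it.\<close>

lemma heyting_nucleus:
  assumes "b \<in> carrier L" "x \<in> S"
  shows "heyting L (nucleus L S b) x = heyting L b x"
proof (rule le_eqI)
  fix z assume z: "z \<in> carrier L"
  have "z \<sqsubseteq> heyting L (nucleus L S b) x \<longleftrightarrow> nucleus L S b \<sqsubseteq> heyting L z x"
    using assms z by (intro le_heyting_swap) (auto intro: in_carrier nucleus_in)
  also have "\<dots> \<longleftrightarrow> b \<sqsubseteq> heyting L z x"
    using assms z by (simp add: nucleus_le_iff heyting_in)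
  also have "\<dots> \<longleftrightarrow> z \<sqsubseteq> heyting L b x"
    using assms z by (simp add: le_heyting_swap in_carrier)
  finally show "z \<sqsubseteq> heyting L (nucleus L S b) x \<longleftrightarrow> z \<sqsubseteq> heyting L b x" .
qed auto

lemma open_sublocale_nucleus:
  assumes "b \<in> carrier L"
  shows "open_sublocale (L\<lparr>carrier := S\<rparr>) (nucleus L S b) = heyting L b ` S"
proof -
  have "heyting (L\<lparr>carrier := S\<rparr>) (nucleus L S b) x = heyting L b x" if "x \<in> S" for x
    using assms that by (simp add: heyting_restrict heyting_nucleus nucleus_in)
  then show ?thesis
    unfolding open_sublocale_def Setcompr_eq_image by (intro image_cong) simp_all
qed

end

text \<open>The element \<open>z\<close> makes the family of closed sublocales nonempty: in HOL an
  empty intersection would be \<open>UNIV\<close> and not \<open>carrier L\<close>. Below,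
  \<open>z\<close> is the bottom or its image under the nucleus.\<close>

lemma is_dense_inI:
  assumes "is_sublocale L T" "z \<in> part L1 L2 i" "T \<subseteq> closed_sublocale L z"
    and "\<And>a. a \<in> part L1 L2 i \<Longrightarrow> T \<subseteq> closed_sublocale L a \<Longrightarrow> carrier L \<subseteq> closed_sublocale L a"
  shows "is_dense_in L L1 L2 i T"
  using assms unfolding is_dense_in_def closed_sublocale_def by blast

lemma is_dense_inD:
  assumes "is_dense_in L L1 L2 i T" "a \<in> part L1 L2 i" "T \<subseteq> closed_sublocale L a"
    "x \<in> carrier L"
  shows "a \<sqsubseteq>\<^bsub>L\<^esub> x"
  using assms unfolding is_dense_in_def closed_sublocale_def by blast

lemma part_image: "part (f ` L1) (f ` L2) k = f ` part L1 L2 k"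
  by (simp add: part_def)

lemma bottom_in_subframe:
  assumes "frame L" "is_subframe L K"
  shows "\<bottom>\<^bsub>L\<^esub> \<in> K"
proof -
  interpret frame L by fact
  have "\<Squnion>\<^bsub>L\<^esub>{} \<in> K"
    using assms(2) by (simp add: is_subframe_def)
  then show ?thesis
    using weak_sup_empty by (simp add: eq_is_equal)
qed

section \<open>Density of traces and the passage of the Baire property to \<open>L\<close>\<close>

context frame_sublocale
begin

lemma is_dense_in_trace:
  assumes zero: "\<bottom> \<in> S" and Ls: "is_subframe L L1" "is_subframe L L2"
    and b: "b \<in> carrier L" and dense: "is_dense_in L L1 L2 i (open_sublocale L b)"
  shows "is_dense_in (L\<lparr>carrier := S\<rparr>) (nucleus L S ` L1) (nucleus L S ` L2) i (heyting L b ` S)"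
proof -
  let ?\<nu> = "nucleus L S"
  have sub: "heyting L b ` S \<subseteq> S"
    using b heyting_in by blast
  have part: "\<bottom> \<in> part L1 L2 i" "part L1 L2 i \<subseteq> carrier L"
    using Ls bottom_in_subframe[OF frame_axioms] by (auto simp: part_def is_subframe_def)
  show ?thesis
  proof (rule is_dense_inI)
    show "is_sublocale (L\<lparr>carrier := S\<rparr>) (heyting L b ` S)"
      by (intro is_sublocale_restrictI is_sublocale_heyting_image b sub)
    show "?\<nu> \<bottom> \<in> part (?\<nu> ` L1) (?\<nu> ` L2) i"
      using part by (simp add: part_image)
    show "heyting L b ` S \<subseteq> closed_sublocale (L\<lparr>carrier := S\<rparr>) (?\<nu> \<bottom>)"
      using sub by (auto simp: closed_sublocale_def nucleus_le_iff subset_iff)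
  next
    fix c assume "c \<in> part (?\<nu> ` L1) (?\<nu> ` L2) i"
      and cl: "heyting L b ` S \<subseteq> closed_sublocale (L\<lparr>carrier := S\<rparr>) c"
    then obtain a where a: "a \<in> part L1 L2 i" "c = ?\<nu> a"
      by (auto simp: part_image)
    then have aL: "a \<in> carrier L"
      using part by blast
    \<comment> \<open>Since \<open>\<bottom> \<in> S\<close>, the element
      \<open>heyting L b \<bottom>\<close> belongs to the trace. It is the least element of
      \<open>open_sublocale L b\<close>, so this single bound yields the inclusion that
      follows.\<close>
    have "a \<sqsubseteq> heyting L b \<bottom>"
      using cl zero a aL b by (auto simp: closed_sublocale_def nucleus_le_iff heyting_in)
    then have "open_sublocale L b \<subseteq> closed_sublocale L a"
      using aL b heyting_mono[OF b]
      by (auto simp: open_sublocale_def closed_sublocale_def intro: le_trans)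
    then have "a \<sqsubseteq> x" if "x \<in> carrier L" for x
      using is_dense_inD[OF dense a(1)] that by blast
    then show "carrier (L\<lparr>carrier := S\<rparr>) \<subseteq> closed_sublocale (L\<lparr>carrier := S\<rparr>) c"
      using a aL by (auto simp: closed_sublocale_def nucleus_le_iff in_carrier)
  qed
qed

lemma is_Baire_if_dense_sublocale_Baire:
  assumes zero: "\<bottom> \<in> S" and Ls: "is_subframe L L1" "is_subframe L L2"
    and Baire: "is_Baire (L\<lparr>carrier := S\<rparr>) (nucleus L S ` L1) (nucleus L S ` L2) i j"
  shows "is_Baire L L1 L2 i j"
  unfolding is_Baire_def
proof (intro allI impI, elim conjE)
  let ?\<nu> = "nucleus L S" and ?M = "L\<lparr>carrier := S\<rparr>"
  fix F assume cF: "countable F"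
    and F: "\<forall>T \<in> F. is_dense_in L L1 L2 i T \<and> is_open_in L L1 L2 j T"
  have part: "\<bottom> \<in> part L1 L2 k" "part L1 L2 k \<subseteq> carrier L" for k
    using Ls bottom_in_subframe[OF frame_axioms] by (auto simp: part_def is_subframe_def)
  have "\<forall>T \<in> F. \<exists>b \<in> part L1 L2 j. T = open_sublocale L b"
    using F by (auto simp: is_open_in_def)
  \<comment> \<open>One generator is chosen per member of \<open>F\<close>, so the family of traces
    is an image of \<open>F\<close> and inherits countability.\<close>
  then obtain b where b: "\<And>T. T \<in> F \<Longrightarrow> b T \<in> part L1 L2 j"
    and T_eq: "\<And>T. T \<in> F \<Longrightarrow> T = open_sublocale L (b T)"
    by metis
  have bL: "b T \<in> carrier L" if "T \<in> F" for T
    using b[OF that] part by blast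
  define G where "G = (\<lambda>T. heyting L (b T) ` S) ` F"
  have "is_dense_in ?M (?\<nu> ` L1) (?\<nu> ` L2) i U \<and> is_open_in ?M (?\<nu> ` L1) (?\<nu> ` L2) j U"
    if U: "U \<in> G" for U
  proof -
    obtain T where T: "T \<in> F" "U = heyting L (b T) ` S"
      using U by (auto simp: G_def)
    then have "is_dense_in L L1 L2 i (open_sublocale L (b T))"
      using F T_eq by metis
    then have dense: "is_dense_in ?M (?\<nu> ` L1) (?\<nu> ` L2) i U"
      unfolding T using zero Ls bL T by (intro is_dense_in_trace)
    have "U = open_sublocale ?M (?\<nu> (b T))"
      using T bL by (simp add: open_sublocale_nucleus)
    then have "is_open_in ?M (?\<nu> ` L1) (?\<nu> ` L2) j U"
      using dense b T by (auto simp: is_open_in_def is_dense_in_def part_image)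
    with dense show ?thesis ..
  qed
  then have dense: "is_dense_in ?M (?\<nu> ` L1) (?\<nu> ` L2) i (S \<inter> \<Inter>G)"
    using Baire cF unfolding is_Baire_def by (force simp: G_def)
  \<comment> \<open>A trace consists of elements \<open>b T \<rightarrow> s\<close> with
    \<open>s \<in> S\<close>, so it is contained in \<open>T\<close>.\<close>
  have G_sub: "S \<inter> \<Inter>G \<subseteq> carrier L \<inter> \<Inter>F"
  proof
    fix x assume x: "x \<in> S \<inter> \<Inter>G"
    have "x \<in> T" if T: "T \<in> F" for T
    proof -
      have "x \<in> heyting L (b T) ` S"
        using x T by (auto simp: G_def)
      then have "x \<in> open_sublocale L (b T)"
        by (auto simp: open_sublocale_def in_carrier)
      then show ?thesis
        using T_eq[OF T] by simp
    qed
    then show "x \<in> carrier L \<inter> \<Inter>F"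
      using x in_carrier by blast
  qed
  show "is_dense_in L L1 L2 i (carrier L \<inter> \<Inter>F)"
  proof (rule is_dense_inI)
    show "is_sublocale L (carrier L \<inter> \<Inter>F)"
      using F by (intro is_sublocale_Inter) (simp add: is_dense_in_def)
    show "\<bottom> \<in> part L1 L2 i"
      by (rule part)
    show "carrier L \<inter> \<Inter>F \<subseteq> closed_sublocale L \<bottom>"
      by (auto simp: closed_sublocale_def)
  next
    fix a assume a: "a \<in> part L1 L2 i" and cl: "carrier L \<inter> \<Inter>F \<subseteq> closed_sublocale L a"
    then have aL: "a \<in> carrier L"
      using part by blast
    \<comment> \<open>Density in \<open>S\<close> is tested at \<open>\<bottom> \<in> S\<close>: the
      adjunction then gives \<open>a \<sqsubseteq> \<bottom>\<close>, so the closed sublocale of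
      \<open>a\<close> is all of \<open>L\<close>.\<close>
    have "?\<nu> a \<sqsubseteq>\<^bsub>?M\<^esub> \<bottom>"
    proof (rule is_dense_inD[OF dense])
      show "?\<nu> a \<in> part (?\<nu> ` L1) (?\<nu> ` L2) i"
        using a by (simp add: part_image)
      show "S \<inter> \<Inter>G \<subseteq> closed_sublocale ?M (?\<nu> a)"
      proof
        fix x assume x: "x \<in> S \<inter> \<Inter>G"
        then have "a \<sqsubseteq> x"
          using subsetD[OF subset_trans[OF G_sub cl]] by (simp add: closed_sublocale_def)
        then show "x \<in> closed_sublocale ?M (?\<nu> a)"
          using x aL by (simp add: closed_sublocale_def nucleus_le_iff)
      qed
      show "\<bottom> \<in> carrier ?M"
        using zero by simp
    qed
    then have "a \<sqsubseteq> \<bottom>"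
      using aL zero by (simp add: nucleus_le_iff)
    then show "carrier L \<subseteq> closed_sublocale L a"
      using aL by (auto simp: closed_sublocale_def intro: le_trans)
  qed
qed

end

theorem corollary3p5:
  fixes L :: "('a, 'b) gorder_scheme" and L1 L2 :: "'a set" and i j :: nat
  assumes "{i, j} = {1, 2}"
    and "is_bilocale L L1 L2"
    and "is_Baire (L\<lparr>carrier := booleanization L\<rparr>)
           (nucleus L (booleanization L) ` L1) (nucleus L (booleanization L) ` L2) i j"
  shows "is_Baire L L1 L2 i j"
proof -
  have Ls: "is_subframe L L1" "is_subframe L L2" and "frame L"
    using assms(2) by (auto simp: is_bilocale_def is_locale_iff_frame)
  interpret frame L by fact
  interpret frame_sublocale L "booleanization L"
    by unfold_locales (rule is_sublocale_booleanization)
  show ?thesis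
    using is_Baire_if_dense_sublocale_Baire[OF bottom_in_booleanization Ls assms(3)] .
qed

end
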